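(* Let $A_{m,k}$ ($m,k\in\mathbb Z_{\ge0}$) be defined by $A_{0,0}=3^{1/4}$, $A_{0,k}=0$ for $k\ge1$, $A_{m,0}=0$ and $A_{m,2m}=\big(\tfrac{3\sqrt3}{2}\big)^m\frac{3^{1/4}}{m!}$ for $m\ge1$, and, for $m\ge1$ and $k\ge1$, $$\frac{k+1}{3}A_{m,k+1}-A_{m,k}+\frac{3\sqrt3}{k}A_{m-1,k-2}=0$$ (with $A_{m,k}=0$ whenever an index is negative). For $n\in\mathbb Z\setminus\{0\}$ let $\delta=\operatorname{sgn}(n)$ and $$W_n=\sum_{k=0}^{2|n|-2}A_{|n|-1,k}\Big(\frac{\delta s}{3}\Big)^k,\qquad s=3\Big(\frac z2\Big)^{2/3}.$$ Then for every $n\in\mathbb Z$ the Ohyama polynomial $\rho_n(s)$ is given by $$\rho_n=\begin{cases}3^{-1/4}\big(s/3\big)^{\frac{|n|-1}{4}}\,Wr(W_{\delta},W_{2\delta},\dots,W_n),& n\text{ odd},\\ \big(s/3\big)^{\frac{|n|}{4}}\,Wr(W_{\delta},W_{2\delta},\dots,W_n),& n\text{ even},\end{cases}$$ where the Wronskians are taken with respect to the variable $z$ (and the empty Wronskian for $n=0$ equals $1$).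
   Context: The Ohyama polynomials $\rho_n(s)$, $n\in\mathbb Z$, are defined by $\rho_0=\rho_1=\rho_{-1}=1$ and the recurrence $$(s+n)\rho_n^2-2s\rho_n\ddot\rho_n+2s(\dot\rho_n)^2-2\rho_n\dot\rho_n=\begin{cases}\rho_{n+1}\rho_{n-1},& n\text{ odd},\\ s\,\rho_{n+1}\rho_{n-1},& n\text{ even},\end{cases}$$ with dots denoting $\mathrm d/\mathrm ds$. The Wronskian is $Wr(f_1,\dots,f_N)=\det\big(\frac{\mathrm d^{i-1}f_j}{\mathrm dz^{i-1}}\big)_{i,j=1}^N$; here $W_j$ are regarded as functions of $z$ via $s=3(z/2)^{2/3}$, $z>0$. For $n>0$ the entries are $W_1,\dots,W_n$; for $n<0$ they are $W_{-1},W_{-2},\dots,W_n$. *)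

theory Defs
  imports Complex_Main "HOL-Analysis.Derivative" "HOL-Computational_Algebra.Polynomial" "Jordan_Normal_Form.Determinant"
begin

text \<open>Left-hand side of the Ohyama recurrence at index n, applied to rho_n = p.\<close>
definition ohyQ :: "int \<Rightarrow> real poly \<Rightarrow> real poly" where
  "ohyQ n p = [:of_int n, 1:] * p^2
      - smult 2 ([:0, 1:] * p * pderiv (pderiv p))
      + smult 2 ([:0, 1:] * (pderiv p)^2)
      - smult 2 (p * pderiv p)"

text \<open>Factor on the right-hand side: 1 for n odd, s for n even.\<close>
definition ohyC :: "int \<Rightarrow> real poly" where
  "ohyC n = (if odd n then 1 else [:0, 1:])"

text \<open>ohy_up k = (rho_k, rho_(k+1)), obtained by solving the recurrence at n = k+1 for rho_(k+2).\<close>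
fun ohy_up :: "nat \<Rightarrow> real poly \<times> real poly" where
  "ohy_up 0 = (1, 1)"
| "ohy_up (Suc k) = (case ohy_up k of (a, b) \<Rightarrow>
      (b, ohyQ (int k + 1) b div (ohyC (int k + 1) * a)))"

text \<open>ohy_down k = (rho_(-k), rho_(-k-1)), solving the recurrence at n = -(k+1) for rho_(-k-2).\<close>
fun ohy_down :: "nat \<Rightarrow> real poly \<times> real poly" where
  "ohy_down 0 = (1, 1)"
| "ohy_down (Suc k) = (case ohy_down k of (a, b) \<Rightarrow>
      (b, ohyQ (- (int k + 1)) b div (ohyC (- (int k + 1)) * a)))"

definition ohyama :: "int \<Rightarrow> real poly" where
  "ohyama n = (if n \<ge> 0 then fst (ohy_up (nat n)) else fst (ohy_down (nat (- n))))"

definition A_conditions :: "(nat \<Rightarrow> nat \<Rightarrow> real) \<Rightarrow> bool" where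
  "A_conditions A \<longleftrightarrow>
     A 0 0 = 3 powr (1/4)
   \<and> (\<forall>k\<ge>1. A 0 k = 0)
   \<and> (\<forall>m\<ge>1. A m 0 = 0)
   \<and> (\<forall>m\<ge>1. A m (2*m) = (3 * sqrt 3 / 2) ^ m * 3 powr (1/4) / fact m)
   \<and> (\<forall>m\<ge>1. \<forall>k\<ge>1.
        (real k + 1) / 3 * A m (k+1) - A m k
        + 3 * sqrt 3 / real k * (if k \<ge> 2 then A (m-1) (k-2) else 0) = 0)"

definition s_of :: "real \<Rightarrow> real" where
  "s_of z = 3 * (z / 2) powr (2/3)"

definition W :: "(nat \<Rightarrow> nat \<Rightarrow> real) \<Rightarrow> int \<Rightarrow> real \<Rightarrow> real" where
  "W A n z = (\<Sum>k = 0..2 * nat \<bar>n\<bar> - 2.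
                 A (nat \<bar>n\<bar> - 1) k * (of_int (sgn n) * s_of z / 3) ^ k)"

definition wronskian :: "(nat \<Rightarrow> real \<Rightarrow> real) \<Rightarrow> nat \<Rightarrow> real \<Rightarrow> real" where
  "wronskian f N z = det (mat N N (\<lambda>(i, j). (deriv ^^ i) (f j) z))"

end

theory Submission
  imports Defs
begin

text \<open>
  Write \<open>N = |n|\<close>, \<open>e = sgn n\<close>. In the variable \<open>s\<close> the \<open>W\<close>'s become polynomials \<open>p\<^sub>m\<close> with
  \<open>p\<^sub>m'' = e p\<^sub>m' - (e / sqrt 3) s p\<^sub>m\<^sub>-\<^sub>1\<close>, a Jordan chain of a second order operator. Row operations
  therefore turn the Wronskian, up to a power of \<open>s\<close> and a constant, into the polynomial determinant
  \<open>\<tau>\<^sub>N\<close> with rows \<open>p\<^sub>j, p\<^sub>j', p\<^sub>j\<^sub>-\<^sub>1, p\<^sub>j\<^sub>-\<^sub>1', \<dots>\<close>. Its Toeplitz structure and Jacobi's identity for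
  the adjugate give a first order relation between \<open>\<rho>\<^sub>N\<^sub>+\<^sub>1\<close>, \<open>\<rho>\<^sub>N\<close>, \<open>\<rho>\<^sub>N\<^sub>-\<^sub>1\<close>. From it a Hirota bilinear
  equation for neighbours follows by induction (a Darboux transformation). Finally, if the Ohyama
  recurrence holds at \<open>N\<close>, both sides of the recurrence at \<open>N + 1\<close> solve the same first order linear
  differential equation, whose homogeneous version has no nonzero polynomial solution since it
  would involve \<open>exp (e s)\<close>.
\<close>

subsection \<open>Determinants\<close>

lemma det_mat_eq_sum:
  "det (mat n n f) = (\<Sum>q | q permutes {0..<n}. signof q * (\<Prod>i = 0..<n. f (i, q i)))"
proof -
  have "det (mat n n f) = (\<Sum>q | q permutes {0..<n}. signof q * (\<Prod>i = 0..<n. mat n n f $$ (i, q i)))"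
    by (rule det_def') simp
  also have "\<dots> = (\<Sum>q | q permutes {0..<n}. signof q * (\<Prod>i = 0..<n. f (i, q i)))"
    by (intro sum.cong prod.cong refl arg_cong2[of _ _ _ _ "(*)"])
       (auto dest: permutes_in_image)
  finally show ?thesis .
qed

text \<open>Leibniz expansion with the factor from row \<open>i\<close> isolated; linearity in one
  row and the product rule for determinants can both be read off it.\<close>

lemma det_mat_row_split:
  assumes "i < n"
  shows "det (mat n n (\<lambda>(k, j). if k = i then u j else f k j))
    = (\<Sum>q | q permutes {0..<n}. signof q * (u (q i) * (\<Prod>k \<in> {0..<n} - {i}. f k (q k))))"
  unfolding det_mat_eq_sum
proof (intro sum.cong refl arg_cong2[of _ _ _ _ "(*)"])
  fix q
  have "(\<Prod>k = 0..<n. case (k, q k) of (k, j) \<Rightarrow> if k = i then u j else f k j)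
      = u (q i) * (\<Prod>k \<in> {0..<n} - {i}. case (k, q k) of (k, j) \<Rightarrow> if k = i then u j else f k j)"
    using assms by (subst prod.remove[of _ i]) auto
  also have "(\<Prod>k \<in> {0..<n} - {i}. case (k, q k) of (k, j) \<Rightarrow> if k = i then u j else f k j)
      = (\<Prod>k \<in> {0..<n} - {i}. f k (q k))"
    by (intro prod.cong) auto
  finally show "(\<Prod>k = 0..<n. case (k, q k) of (k, j) \<Rightarrow> if k = i then u j else f k j)
      = u (q i) * (\<Prod>k \<in> {0..<n} - {i}. f k (q k))" .
qed

lemma det_mat_row_lincomb:
  assumes "i < n"
  shows "det (mat n n (\<lambda>(k, j). if k = i then x * u j + y * v j else f k j))
    = x * det (mat n n (\<lambda>(k, j). if k = i then u j else f k j))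
    + y * det (mat n n (\<lambda>(k, j). if k = i then v j else f k j))"
  unfolding det_mat_row_split[OF assms]
  by (simp add: sum_distrib_left flip: sum.distrib) (intro sum.cong refl, simp add: algebra_simps)

text \<open>Product rule in each Leibniz summand: signs are constant polynomials, and regrouping by
  the differentiated row gives determinants again.\<close>

lemma pderiv_det:
  fixes f :: "nat \<Rightarrow> nat \<Rightarrow> 'a::idom poly"
  shows "pderiv (det (mat n n (\<lambda>(i, j). f i j)))
    = (\<Sum>i<n. det (mat n n (\<lambda>(k, j). if k = i then pderiv (f i j) else f k j)))"
proof -
  have sgn0: "pderiv (signof q :: 'a poly) = 0" for q :: "nat \<Rightarrow> nat"
    by (cases "sign q = 1") (auto simp: sign_def pderiv_minus)
  have "pderiv (det (mat n n (\<lambda>(i, j). f i j)))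
      = (\<Sum>q | q permutes {0..<n}. \<Sum>i<n. signof q * (pderiv (f i (q i)) * (\<Prod>k \<in> {0..<n} - {i}. f k (q k))))"
    unfolding det_mat_eq_sum higher_pderiv_sum[of 1, simplified]
    by (intro sum.cong refl)
       (simp add: pderiv_mult sgn0 pderiv_prod sum_distrib_left atLeast0LessThan mult.commute)
  also have "\<dots> = (\<Sum>i<n. det (mat n n (\<lambda>(k, j). if k = i then pderiv (f i j) else f k j)))"
    by (subst sum.swap) (intro sum.cong refl, subst det_mat_row_split, auto)
  finally show ?thesis .
qed

lemma det_mat_first_col:
  assumes "\<And>i. 0 < i \<Longrightarrow> i \<le> n \<Longrightarrow> f i 0 = 0"
  shows "det (mat (Suc n) (Suc n) (\<lambda>(i, j). f i j)) = f 0 0 * det (mat n n (\<lambda>(i, j). f (Suc i) (Suc j)))"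
proof -
  let ?M = "mat (Suc n) (Suc n) (\<lambda>(i, j). f i j)"
  have "det ?M = (\<Sum>i<Suc n. ?M $$ (i, 0) * cofactor ?M i 0)"
    by (rule laplace_expansion_column) auto
  also have "\<dots> = (\<Sum>i\<in>{0}. ?M $$ (i, 0) * cofactor ?M i 0)"
    by (rule sum.mono_neutral_right) (auto simp: assms)
  also have "\<dots> = f 0 0 * det (mat_delete ?M 0 0)" by (simp add: cofactor_def)
  also have "mat_delete ?M 0 0 = mat n n (\<lambda>(i, j). f (Suc i) (Suc j))"
    by (rule eq_matI) (auto simp: mat_delete_def)
  finally show ?thesis .
qed

lemma det_mat_last_col:
  assumes "\<And>i. 0 < i \<Longrightarrow> i \<le> n \<Longrightarrow> f i n = 0"
  shows "det (mat (Suc n) (Suc n) (\<lambda>(i, j). f i j)) = (-1)^n * f 0 n * det (mat n n (\<lambda>(i, j). f (Suc i) j))"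
proof -
  let ?M = "mat (Suc n) (Suc n) (\<lambda>(i, j). f i j)"
  have "det ?M = (\<Sum>i<Suc n. ?M $$ (i, n) * cofactor ?M i n)"
    by (rule laplace_expansion_column) auto
  also have "\<dots> = (\<Sum>i\<in>{0}. ?M $$ (i, n) * cofactor ?M i n)"
    by (rule sum.mono_neutral_right) (auto simp: assms)
  also have "\<dots> = (-1)^n * f 0 n * det (mat_delete ?M 0 n)" by (simp add: cofactor_def)
  also have "mat_delete ?M 0 n = mat n n (\<lambda>(i, j). f (Suc i) j)"
    by (rule eq_matI) (auto simp: mat_delete_def)
  finally show ?thesis .
qed

lemma det_mat_2: "det (mat 2 2 (\<lambda>(i, j). f i j)) = f 0 0 * f 1 1 - f 0 1 * f 1 0"
proof -
  let ?M = "mat 2 2 (\<lambda>(i, j). f i j)"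
  have "det ?M = (\<Sum>i<2. ?M $$ (i, 0) * cofactor ?M i 0)"
    by (rule laplace_expansion_column) auto
  then show ?thesis
    by (simp add: numeral_2_eq_2 cofactor_def mat_delete_def det_single)
qed

text \<open>Jacobi's identity for the last 2x2 block of the adjugate. \<open>B\<close> is the
  identity with its last two columns replaced by those of the adjugate, so \<open>X * B\<close> is
  block triangular; comparing determinants, one factor \<open>det X\<close> cancels.\<close>

lemma det_adjugate_corner:
  fixes X :: "'a::idom mat"
  assumes X: "X \<in> carrier_mat (m + 2) (m + 2)" and nz: "det X \<noteq> 0"
  shows "cofactor X m m * cofactor X (m+1) (m+1) - cofactor X (m+1) m * cofactor X m (m+1)
    = det X * det (mat m m (\<lambda>(i, j). X $$ (i, j)))"
proof -
  define A1 A2 A3 A4 where "A1 = mat m m (\<lambda>(i, j). X $$ (i, j))"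
    and "A2 = mat m 2 (\<lambda>(i, j). X $$ (i, j + m))"
    and "A3 = mat 2 m (\<lambda>(i, j). X $$ (i + m, j))"
    and "A4 = mat 2 2 (\<lambda>(i, j). X $$ (i + m, j + m))"
  have cA: "A1 \<in> carrier_mat m m" "A2 \<in> carrier_mat m 2" "A3 \<in> carrier_mat 2 m" "A4 \<in> carrier_mat 2 2"
    by (auto simp: A1_def A2_def A3_def A4_def)
  have XA: "X = four_block_mat A1 A2 A3 A4"
    using X by (intro eq_matI) (auto simp: A1_def A2_def A3_def A4_def four_block_mat_def Let_def)
  define B2 B4 where "B2 = mat m 2 (\<lambda>(i, j). cofactor X (j + m) i)"
    and "B4 = mat 2 2 (\<lambda>(i, j). cofactor X (j + m) (i + m))"
  have cB: "B2 \<in> carrier_mat m 2" "B4 \<in> carrier_mat 2 2" by (auto simp: B2_def B4_def)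
  define B where "B = four_block_mat (1\<^sub>m m) B2 (0\<^sub>m 2 m) B4"
  have cBB: "B \<in> carrier_mat (m + 2) (m + 2)" using cB unfolding B_def by auto
  have detB: "det B = det B4"
    unfolding B_def by (subst det_four_block_mat_lower_left_zero) (use cB in auto)
  have colB: "col B j = col (adj_mat X) j" if "m \<le> j" "j < m + 2" for j
    using that X cB by (intro eq_vecI) (auto simp: B_def adj_mat_def B2_def B4_def)
  have colB': "col B j = unit_vec (m + 2) j" if "j < m" for j
    using that cB by (intro eq_vecI) (auto simp: B_def)
  have XB: "X * B = four_block_mat A1 (0\<^sub>m m 2) A3 (det X \<cdot>\<^sub>m 1\<^sub>m 2)" (is "_ = ?R")
  proof (rule eq_matI)
    fix i j assume "i < dim_row ?R" "j < dim_col ?R"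
    then have ij: "i < m + 2" "j < m + 2" using cA by auto
    show "(X * B) $$ (i, j) = ?R $$ (i, j)"
    proof (cases "j < m")
      case True
      have "(X * B) $$ (i, j) = row X i \<bullet> unit_vec (m + 2) j"
        using ij X cBB colB'[OF True] by simp
      also have "\<dots> = X $$ (i, j)" using X ij by simp
      also have "\<dots> = ?R $$ (i, j)" using True ij cA by (auto simp: A1_def A3_def)
      finally show ?thesis .
    next
      case False
      have "(X * B) $$ (i, j) = row X i \<bullet> col (adj_mat X) j"
        using ij X cBB colB[of j] False by simp
      also have "\<dots> = (X * adj_mat X) $$ (i, j)" using ij X adj_mat(1)[OF X] by simp
      also have "\<dots> = ?R $$ (i, j)" using False ij cA unfolding adj_mat(2)[OF X] by auto
      finally show ?thesis .
    qed
  qed (use X cBB cA in auto)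
  have "det X * det B4 = det (X * B)" using det_mult[OF X cBB] detB by simp
  also have "\<dots> = det A1 * det (det X \<cdot>\<^sub>m 1\<^sub>m 2)"
    unfolding XB by (rule det_four_block_mat_upper_right_zero) (use cA in auto)
  also have "\<dots> = det X * (det X * det A1)" by (simp add: power2_eq_square)
  finally have "det B4 = det X * det A1" using nz by simp
  moreover have "det B4 = cofactor X m m * cofactor X (m+1) (m+1) - cofactor X (m+1) m * cofactor X m (m+1)"
    unfolding B4_def by (subst det_mat_2) (simp add: add.commute)
  ultimately show ?thesis by (simp add: A1_def)
qed

subsection \<open>Bilinear identities\<close>

text \<open>In this subsection \<open>a\<close>, \<open>b\<close>, \<open>c\<close> stand for \<open>\<rho>\<^sub>n\<^sub>-\<^sub>1\<close>, \<open>\<rho>\<^sub>n\<close>, \<open>\<rho>\<^sub>n\<^sub>+\<^sub>1\<close>, a numeral suffix counts derivatives,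
  and even/odd refers to \<open>n\<close>.\<close>

lemma hirota_step_even:
  fixes a b c d s m :: "'a::idom"
  assumes "c1 * a - c * a1 - d * c * a = - (d * b^2)"
    and "c2 * a - c * a2 - d * (c1 * a + c * a1) = - (d * (2 * b * b1))"
    and "s * (b2 * a - 2 * b1 * a1 + b * a2) - b1 * a - d * s * (b1 * a - b * a1) + d * m * a * b = 0"
    and "a \<noteq> 0"
  shows "s * (c2 * b - 2 * c1 * b1 + c * b2) - c * b1 - d * s * (c1 * b - c * b1) + d * m * b * c = 0"
    (is "?II = 0")
proof -
  \<comment> \<open>After multiplication by \<open>a\<close> the claim is a combination of the
    hypotheses: \<open>c\<close> times the equation for the pair \<open>a\<close>, \<open>b\<close>,
    then \<open>s * b\<close> times the differentiated first order relation and
    \<open>- 2 * s * b1\<close> times the relation itself.\<close>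
  have "a * ?II = c * (s * (b2 * a - 2 * b1 * a1 + b * a2) - b1 * a - d * s * (b1 * a - b * a1) + d * m * a * b)
     + s * b * (c2 * a - c * a2 - d * (c1 * a + c * a1) + d * (2 * b * b1))
     - 2 * s * b1 * (c1 * a - c * a1 - d * c * a + d * b^2)"
    by (simp add: algebra_simps power2_eq_square)
  also have "\<dots> = 0" using assms(1-3) by simp
  finally show ?thesis using assms(4) by simp
qed

text \<open>Here the first order relation carries a factor \<open>s\<close>, whose derivative adds a
  \<open>b^2\<close>. Cancelling it takes an extra multiplier \<open>- b\<close>, and the term
  \<open>d * c * a\<close> of the relation then raises \<open>m\<close> to
  \<open>m + 1\<close>.\<close>

lemma hirota_step_odd:
  fixes a b c d s m :: "'a::idom"
  assumes "c1 * a - c * a1 - d * c * a = - (d * s * b^2)"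
    and "c2 * a - c * a2 - d * (c1 * a + c * a1) = - (d * (b^2 + s * (2 * b * b1)))"
    and "s * (b2 * a - 2 * b1 * a1 + b * a2) - b * a1 - d * s * (b1 * a - b * a1) + d * m * a * b = 0"
    and "a \<noteq> 0"
  shows "s * (c2 * b - 2 * c1 * b1 + c * b2) - c1 * b - d * s * (c1 * b - c * b1) + d * (m + 1) * b * c = 0"
    (is "?II = 0")
proof -
  have "a * ?II = c * (s * (b2 * a - 2 * b1 * a1 + b * a2) - b * a1 - d * s * (b1 * a - b * a1) + d * m * a * b)
     + s * b * (c2 * a - c * a2 - d * (c1 * a + c * a1) + d * (b^2 + s * (2 * b * b1)))
     - (2 * s * b1 + b) * (c1 * a - c * a1 - d * c * a + d * s * b^2)"
    by (simp add: algebra_simps power2_eq_square)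
  also have "\<dots> = 0" using assms(1-3) by simp
  finally show ?thesis using assms(4) by simp
qed

text \<open>\<open>X\<close>, \<open>Y\<close> are the left-hand sides of the Ohyama recurrence at \<open>n\<close> and \<open>n + 1\<close>.\<close>

lemma backlund_step_even:
  fixes b c d s m X Y :: "'a::idom"
  assumes X: "X = (s + d * (2 * m)) * b^2 - 2 * (s * b * b2) + 2 * (s * b1^2) - 2 * (b * b1)"
    and X1: "X1 = b^2 + (s + d * (2 * m)) * (2 * b * b1) - 2 * (b * b2 + s * b1 * b2 + s * b * b3)
        + 2 * (b1^2 + s * (2 * b1 * b2)) - 2 * (b1^2 + b * b2)"
    and Y: "Y = (s + d * (2 * m + 1)) * c^2 - 2 * (s * c * c2) + 2 * (s * c1^2) - 2 * (c * c1)"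
    and Y1: "Y1 = c^2 + (s + d * (2 * m + 1)) * (2 * c * c1) - 2 * (c * c2 + s * c1 * c2 + s * c * c3)
        + 2 * (c1^2 + s * (2 * c1 * c2)) - 2 * (c1^2 + c * c2)"
    and J: "s * c * X1 = d * s^2 * c * b^2 + (- (d * s * c) + c + 2 * s * c1) * X"
    and II: "s * (c2 * b - 2 * c1 * b1 + c * b2) - c * b1 - d * s * (c1 * b - c * b1) + d * m * b * c = 0"
    and II1: "c2 * b - 2 * c1 * b1 + c * b2 + s * (c3 * b - c2 * b1 - c1 * b2 + c * b3)
       - c1 * b1 - c * b2 - d * (c1 * b - c * b1) - d * s * (c2 * b - c * b2) + d * m * (b1 * c + b * c1) = 0"
    and d: "d * d = 1" and "b \<noteq> 0"
  shows "s * b * Y1 = (d * s * b + 2 * s * b1) * Y - d * s^2 * b * c^2"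
proof -
  let ?J = "s * c * X1 - d * s^2 * c * b^2 - (- (d * s * c) + c + 2 * s * c1) * X"
  let ?II = "s * (c2 * b - 2 * c1 * b1 + c * b2) - c * b1 - d * s * (c1 * b - c * b1) + d * m * b * c"
  let ?II1 = "c2 * b - 2 * c1 * b1 + c * b2 + s * (c3 * b - c2 * b1 - c1 * b2 + c * b3)
       - c1 * b1 - c * b2 - d * (c1 * b - c * b1) - d * s * (c2 * b - c * b2) + d * m * (b1 * c + b * c1)"
  have dd: "d * (d * u) = u" for u using d by (simp flip: mult.assoc)
  \<comment> \<open>The bracket with \<open>?II1\<close> and \<open>?II\<close> is
    \<open>(b * c)^2\<close> times the derivative of \<open>?II / (b * c)\<close>; it trades the
    third derivative of \<open>b\<close> in \<open>?J\<close> for that of \<open>c\<close>.\<close>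
  have "b * (s * b * Y1 - ((d * s * b + 2 * s * b1) * Y - d * s^2 * b * c^2)) =
     - c * ?J - 2 * s * (b * c * ?II1 - (b1 * c + b * c1) * ?II) - 2 * b * c * ?II"
    unfolding X X1 Y Y1
    by (simp add: algebra_simps power2_eq_square d dd)
  also have "\<dots> = 0" using J II II1 by simp
  finally show ?thesis using \<open>b \<noteq> 0\<close> by simp
qed

text \<open>The multipliers are those of the even case. The logarithmic derivative of the factor
  \<open>s\<close> in the recurrence now enters at \<open>n + 1\<close> instead of \<open>n\<close>:
  hence no summand \<open>c\<close> in \<open>J\<close>, and a summand \<open>b\<close> in the
  conclusion.\<close>

lemma backlund_step_odd:
  fixes b c d s m X Y :: "'a::idom"
  assumes X: "X = (s + d * (2 * m - 1)) * b^2 - 2 * (s * b * b2) + 2 * (s * b1^2) - 2 * (b * b1)"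
    and X1: "X1 = b^2 + (s + d * (2 * m - 1)) * (2 * b * b1) - 2 * (b * b2 + s * b1 * b2 + s * b * b3)
        + 2 * (b1^2 + s * (2 * b1 * b2)) - 2 * (b1^2 + b * b2)"
    and Y: "Y = (s + d * (2 * m)) * c^2 - 2 * (s * c * c2) + 2 * (s * c1^2) - 2 * (c * c1)"
    and Y1: "Y1 = c^2 + (s + d * (2 * m)) * (2 * c * c1) - 2 * (c * c2 + s * c1 * c2 + s * c * c3)
        + 2 * (c1^2 + s * (2 * c1 * c2)) - 2 * (c1^2 + c * c2)"
    and J: "s * c * X1 = d * s^2 * c * b^2 + (- (d * s * c) + 2 * s * c1) * X"
    and II: "s * (c2 * b - 2 * c1 * b1 + c * b2) - c1 * b - d * s * (c1 * b - c * b1) + d * m * b * c = 0"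
    and II1: "c2 * b - 2 * c1 * b1 + c * b2 + s * (c3 * b - c2 * b1 - c1 * b2 + c * b3)
       - c1 * b1 - c2 * b - d * (c1 * b - c * b1) - d * s * (c2 * b - c * b2) + d * m * (b1 * c + b * c1) = 0"
    and d: "d * d = 1" and "b \<noteq> 0"
  shows "s * b * Y1 = (d * s * b + b + 2 * s * b1) * Y - d * s^2 * b * c^2"
proof -
  let ?J = "s * c * X1 - d * s^2 * c * b^2 - (- (d * s * c) + 2 * s * c1) * X"
  let ?II = "s * (c2 * b - 2 * c1 * b1 + c * b2) - c1 * b - d * s * (c1 * b - c * b1) + d * m * b * c"
  let ?II1 = "c2 * b - 2 * c1 * b1 + c * b2 + s * (c3 * b - c2 * b1 - c1 * b2 + c * b3)
       - c1 * b1 - c2 * b - d * (c1 * b - c * b1) - d * s * (c2 * b - c * b2) + d * m * (b1 * c + b * c1)"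
  have dd: "d * (d * u) = u" for u using d by (simp flip: mult.assoc)
  have "b * (s * b * Y1 - ((d * s * b + b + 2 * s * b1) * Y - d * s^2 * b * c^2)) =
     - c * ?J - 2 * s * (b * c * ?II1 - (b1 * c + b * c1) * ?II) - 2 * b * c * ?II"
    unfolding X X1 Y Y1
    by (simp add: algebra_simps power2_eq_square d dd)
  also have "\<dots> = 0" using J II II1 by simp
  finally show ?thesis using \<open>b \<noteq> 0\<close> by simp
qed

subsection \<open>Determinants of Jordan chains\<close>

text \<open>Exponent of the constant \<open>- (sqrt 3 * e)\<close> in the Wronskian: row
  \<open>i\<close> supplies \<open>i div 2\<close> such factors.\<close>

definition row_exponent :: "nat \<Rightarrow> nat" where
  "row_exponent n = (\<Sum>i<n. i div 2)"

text \<open>\<open>e\<close> is the sign of the index and \<open>p m\<close> the polynomial in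
  \<open>s\<close> behind \<open>W\<close> at index \<open>e * (m + 1)\<close>, so both signs are
  treated at once.\<close>

locale wave_chain =
  fixes e :: int and p :: "nat \<Rightarrow> real poly"
  assumes e_sq: "e * e = 1"
    and p_0: "p 0 = [:3 powr (1/4):]"
    and p_Suc: "pderiv (pderiv (p (Suc m))) =
      smult (of_int e) (pderiv (p (Suc m))) - smult (of_int e / sqrt 3) ([:0, 1:] * p m)"
begin

text \<open>The guard makes \<open>p\<close> vanish at negative indices, where truncated subtraction
  would return \<open>p 0\<close>.\<close>

definition entry :: "nat \<Rightarrow> nat \<Rightarrow> real poly" where
  "entry l j = (if l div 2 \<le> j then
     (if even l then p (j - l div 2) else pderiv (p (j - l div 2))) else 0)"

text \<open>Coefficient of row \<open>l + 1\<close> in the derivative of row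
  \<open>l\<close>.\<close>

definition coupling :: "nat \<Rightarrow> real poly" where
  "coupling l = (if even l then 1 else [:0, - (of_int e / sqrt 3):])"

definition tau :: "nat \<Rightarrow> real poly" where
  "tau n = det (mat n n (\<lambda>(i, j). entry i j))"

text \<open>\<open>tau (Suc n)\<close> with its last row advanced by one, which is what
  differentiation leaves besides a multiple of \<open>tau (Suc n)\<close>.\<close>

definition tau_next :: "nat \<Rightarrow> real poly" where
  "tau_next n = det (mat (Suc n) (Suc n) (\<lambda>(i, j). entry (if i = n then Suc n else i) j))"

lemma entry_shift [simp]: "entry (Suc (Suc l)) (Suc j) = entry l j"
  by (auto simp: entry_def)

lemma entry_0 [simp]: "0 < l \<Longrightarrow> entry l 0 = 0"
  by (cases "l = 1") (auto simp: entry_def p_0 pderiv_pCons)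

lemma entry_00 [simp]: "entry 0 j = p j"
  by (auto simp: entry_def)

text \<open>Even rows hold chain members and odd rows their derivatives; differentiating an odd row,
  the second order equation leads back to the chain. At the end of the chain all terms vanish
  because \<open>p 0\<close> is constant.\<close>

lemma pderiv_entry:
  "pderiv (entry l j) = [:if odd l then of_int e else 0:] * entry l j + coupling l * entry (Suc l) j"
proof (cases "even l")
  case True
  then show ?thesis by (auto simp: entry_def coupling_def)
next
  case False
  then obtain k where l: "l = 2 * k + 1" by (auto elim: oddE)
  show ?thesis
  proof (cases "j \<le> k")
    case True
    then show ?thesis by (auto simp: l entry_def coupling_def p_0 pderiv_pCons)
  next
    case False
    then obtain m where j: "j = k + Suc m" using less_iff_Suc_add by (metis add_Suc_right not_le)
    have "[:0, - (of_int e / sqrt 3):] * p m = - smult (of_int e / sqrt 3) ([:0, 1:] * p m)"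
      by (simp flip: smult_minus_left)
    then show ?thesis by (simp add: l j entry_def coupling_def p_Suc)
  qed
qed

text \<open>Advancing row \<open>i\<close> to row \<open>i + 1\<close> repeats a row unless row
  \<open>i\<close> is the last. The diagonal parts contribute \<open>e\<close> for each of the
  \<open>Suc n div 2\<close> odd rows.\<close>

lemma pderiv_tau:
  "pderiv (tau (Suc n)) = [:of_int e * real (Suc n div 2):] * tau (Suc n) + coupling n * tau_next n"
proof -
  let ?row = "\<lambda>i. det (mat (Suc n) (Suc n) (\<lambda>(k, j). if k = i then entry (Suc i) j else entry k j))"
  have row: "?row i = (if i = n then tau_next n else 0)" if "i < Suc n" for i
  proof (cases "i = n")
    case True
    then show ?thesis unfolding tau_next_def
      by (auto intro!: arg_cong[of _ _ det] cong_mat)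
  next
    case False
    then have "?row i = 0"
      using that by (intro det_identical_rows[of _ "Suc n" i "Suc i"]) (auto simp: row_def)
    then show ?thesis using False by simp
  qed
  have same: "det (mat (Suc n) (Suc n) (\<lambda>(k, j). if k = i then entry i j else entry k j)) = tau (Suc n)" for i
    unfolding tau_def by (auto intro!: arg_cong[of _ _ det] cong_mat)
  have "pderiv (tau (Suc n)) = (\<Sum>i<Suc n. det (mat (Suc n) (Suc n)
      (\<lambda>(k, j). if k = i then pderiv (entry i j) else entry k j)))"
    unfolding tau_def by (rule pderiv_det)
  also have "\<dots> = (\<Sum>i<Suc n. [:if odd i then of_int e else 0:] * tau (Suc n)
      + coupling i * (if i = n then tau_next n else 0))"
    unfolding pderiv_entry
    by (intro sum.cong refl, subst det_mat_row_lincomb) (auto simp: same row)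
  also have "\<dots> = (\<Sum>i<Suc n. [:if odd i then of_int e else 0:]) * tau (Suc n) + coupling n * tau_next n"
    by (subst sum.distrib, subst sum.remove[of _ n "\<lambda>i. coupling i * (if i = n then tau_next n else 0)"])
       (auto simp: sum_distrib_right distrib_right)
  also have "(\<Sum>i<k. [:if odd i then of_int e else 0 :: real:]) = [:of_int e * real (k div 2):]" for k
    by (induction k) (auto elim!: evenE oddE simp: algebra_simps)
  finally show ?thesis .
qed

lemma tau_jacobi:
  assumes nz: "tau (k + 2) \<noteq> 0"
  shows "tau_next k * tau (k + 3) - tau (k + 1) * tau_next (k + 2) = - (tau (k + 2))\<^sup>2"
proof -
  define m where "m = Suc k"
  \<comment> \<open>Rows \<open>1, \<dots>, k + 3\<close> and columns \<open>1, \<dots>, k + 2\<close> of \<open>entry\<close>, bordered by a unit column. Since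
    column \<open>0\<close> of \<open>entry\<close> is \<open>p 0\<close> times a unit vector and \<open>entry (l + 2) (j + 1) = entry l j\<close>, all
    minors in Jacobi's identity are again \<open>tau\<close> or \<open>tau_next\<close>.\<close>
  define f where "f i j = (if j < Suc m then entry (Suc i) (Suc j) else if i = 0 then 1 else 0)" for i j
  define X where "X = mat (m + 2) (m + 2) (\<lambda>(i, j). f i j)"
  have X: "X \<in> carrier_mat (m + 2) (m + 2)" by (simp add: X_def)
  have detX: "det X = (-1)^(Suc m) * tau (Suc m)"
    unfolding X_def numeral_2_eq_2 add_Suc_right add_0_right tau_def
    by (subst det_mat_last_col) (auto simp: f_def intro!: arg_cong[of _ _ det] cong_mat)
  have tau_red: "tau (Suc n) = p 0 * det (mat n n (\<lambda>(i, j). entry (Suc i) (Suc j)))" for n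
    unfolding tau_def by (subst det_mat_first_col) auto
  have A: "tau (Suc m) = p 0 * det (mat m m (\<lambda>(i, j). X $$ (i, j)))"
    unfolding tau_red by (auto simp: X_def f_def intro!: arg_cong[of _ _ det] cong_mat)
  have c11: "p 0 * cofactor X (m+1) (m+1) = tau (Suc (Suc m))"
    unfolding tau_red cofactor_def mat_delete_def
    by (auto simp: X_def f_def intro!: arg_cong[of _ _ det] cong_mat)
  have c01: "p 0 * cofactor X m (m+1) = - tau_next (Suc m)"
    unfolding tau_next_def cofactor_def mat_delete_def
    by (subst det_mat_first_col) (auto simp: X_def f_def intro!: arg_cong[of _ _ det] cong_mat)
  have c10: "cofactor X (m+1) m = - ((-1)^m * tau m)"
  proof -
    have "mat_delete X (m+1) m = mat (Suc m) (Suc m)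
        (\<lambda>(i, j). if j < m then entry (Suc i) (Suc j) else if i = 0 then 1 else 0)"
      by (rule eq_matI) (auto simp: X_def f_def mat_delete_def)
    moreover have "det \<dots> = (-1)^m * tau m"
      unfolding tau_def by (subst det_mat_last_col) (auto intro!: arg_cong[of _ _ det] cong_mat)
    ultimately show ?thesis by (simp add: cofactor_def)
  qed
  have c00: "cofactor X m m = (-1)^m * tau_next k"
  proof -
    define g where "g i j = (if j < m then entry (Suc (if i < m then i else Suc i)) (Suc j)
      else if i = 0 then 1 else 0)" for i j
    have "mat_delete X m m = mat (Suc m) (Suc m) (\<lambda>(i, j). g i j)"
      by (rule eq_matI) (auto simp: X_def f_def g_def mat_delete_def m_def)
    also have "det \<dots> = (-1)^m * g 0 m * det (mat m m (\<lambda>(i, j). g (Suc i) j))"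
      by (rule det_mat_last_col) (auto simp: g_def)
    also have "mat m m (\<lambda>(i, j). g (Suc i) j)
        = mat (Suc k) (Suc k) (\<lambda>(i, j). entry (if i = k then Suc k else i) j)"
      unfolding m_def by (rule cong_mat) (auto simp: g_def m_def)
    finally show ?thesis by (simp add: cofactor_def tau_next_def g_def flip: mult_2)
  qed
  \<comment> \<open>In each of the three products exactly one factor lacks the constant
    \<open>p 0\<close> lost with column 0, so one multiplication by \<open>p 0\<close> repairs them
    all.\<close>
  have "p 0 * (cofactor X m m * cofactor X (m+1) (m+1) - cofactor X (m+1) m * cofactor X m (m+1))
      = p 0 * (det X * det (mat m m (\<lambda>(i, j). X $$ (i, j))))"
    using nz by (subst det_adjugate_corner[OF X]) (auto simp: detX m_def)
  then have "cofactor X m m * (p 0 * cofactor X (m+1) (m+1)) - cofactor X (m+1) m * (p 0 * cofactor X m (m+1))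
      = det X * (p 0 * det (mat m m (\<lambda>(i, j). X $$ (i, j))))"
    by (simp add: algebra_simps)
  then have "(-1)^m * (tau_next k * tau (Suc (Suc m)) - tau m * tau_next (Suc m))
      = (-1)^m * (- (tau (Suc m))\<^sup>2)"
    unfolding c00 c01 c10 c11 detX A[symmetric] by (simp add: algebra_simps power2_eq_square)
  then have "tau_next k * tau (Suc (Suc m)) - tau m * tau_next (Suc m) = - (tau (Suc m))\<^sup>2"
    by (simp only: mult_cancel_left) simp
  then show ?thesis by (simp add: m_def numeral_3_eq_3)
qed

lemma tau_0 [simp]: "tau 0 = 1"
  by (simp add: tau_def)

lemma tau_1: "tau (Suc 0) = p 0"
  unfolding tau_def by (subst det_mat_first_col) auto

text \<open>In \<open>pderiv_tau\<close> the couplings for \<open>tau (m + 2)\<close> and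
  \<open>tau m\<close> agree and the diagonal coefficients differ by \<open>e\<close>; what remains
  is the combination evaluated by \<open>tau_jacobi\<close>. For \<open>m = 0\<close> there is no
  lower \<open>tau_next\<close>, hence the direct computation.\<close>

lemma tau_wronskian:
  assumes "tau (Suc m) \<noteq> 0"
  shows "pderiv (tau (m + 2)) * tau m - tau (m + 2) * pderiv (tau m) - [:of_int e:] * tau (m + 2) * tau m
    = coupling (Suc m) * (tau (Suc m))\<^sup>2"
proof (cases m)
  case 0
  have "tau_next 1 = (p 0)\<^sup>2"
    unfolding tau_next_def
    using det_mat_2[of "\<lambda>i j. entry (if i = 1 then Suc 1 else i) j"] entry_shift[of 0 0]
    by (simp add: numeral_2_eq_2 power2_eq_square del: entry_shift)
  then show ?thesis
    using pderiv_tau[of 1] by (simp add: 0 tau_1 numeral_2_eq_2 pderiv_1)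
next
  case (Suc k)
  have c: "coupling (k + 2) = coupling k" by (simp add: coupling_def)
  have "[:of_int e * real ((k + 3) div 2):] = [:of_int e * real ((k + 1) div 2):] + [:of_int e:]"
  proof -
    have "(k + 3) div 2 = Suc ((k + 1) div 2)" by presburger
    then show ?thesis by (simp add: algebra_simps)
  qed
  then have "pderiv (tau (k + 3)) * tau (k + 1) - tau (k + 3) * pderiv (tau (k + 1)) - [:of_int e:] * tau (k + 3) * tau (k + 1)
     = - (coupling k * (tau_next k * tau (k + 3) - tau (k + 1) * tau_next (k + 2)))"
    using pderiv_tau[of "k + 2"] pderiv_tau[of k] c
    by (simp add: algebra_simps numeral_3_eq_3 smult_add_left)
  also have "\<dots> = coupling k * (tau (k + 2))\<^sup>2"
    using assms Suc by (subst tau_jacobi) auto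
  finally show ?thesis using c by (simp add: Suc numeral_3_eq_3)
qed

text \<open>If \<open>tau (m + 2)\<close> were zero, \<open>tau_wronskian\<close> would force
  \<open>tau (m + 1)\<close> to vanish.\<close>

lemma tau_nonzero: "tau n \<noteq> 0"
proof -
  have "tau (Suc m) \<noteq> 0" for m
  proof (induction m)
    case 0
    then show ?case by (simp add: tau_1 p_0)
  next
    case (Suc m)
    have "coupling (Suc m) \<noteq> 0" using e_sq by (auto simp: coupling_def)
    then show ?case using tau_wronskian[OF Suc] Suc by auto
  qed
  then show ?thesis by (cases n) auto
qed

section \<open>Normalised determinants and their bilinear equations\<close>

definition rho_factor :: "nat \<Rightarrow> real" where
  "rho_factor n = (if odd n then 3 powr (-1/4) else 1) * (- (sqrt 3 * of_int e)) ^ row_exponent n"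

definition rho :: "nat \<Rightarrow> real poly" where
  "rho n = smult (rho_factor n) (tau n)"

lemma of_int_e_sq [simp]: "(of_int e :: real) * of_int e = 1"
  using e_sq by (metis of_int_1 of_int_mult)

lemma rho_factor_nonzero: "rho_factor n \<noteq> 0"
  using of_int_e_sq by (auto simp: rho_factor_def simp del: of_int_e_sq)

lemma rho_nonzero: "rho n \<noteq> 0"
  by (simp add: rho_def rho_factor_nonzero tau_nonzero)

lemma rho_0 [simp]: "rho 0 = 1"
  by (simp add: rho_def rho_factor_def row_exponent_def)

lemma rho_1 [simp]: "rho (Suc 0) = 1"
  by (simp add: rho_def rho_factor_def row_exponent_def tau_1 p_0 powr_minus flip: one_pCons)

text \<open>The second difference of \<open>row_exponent\<close> at \<open>m\<close> is 0 for even
  and 1 for odd \<open>m\<close>. With the square of \<open>3 powr (-1/4)\<close> being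
  \<open>1 / sqrt 3\<close>, all irrational constants cancel.\<close>

lemma rho_factor_coupling:
  "smult (rho_factor (m + 2) * rho_factor m) (coupling (Suc m))
    = smult (- (of_int e) * (rho_factor (Suc m))\<^sup>2) (if even m then [:0, 1:] else 1)"
proof -
  define c where "c = - (sqrt 3 * of_int e :: real)"
  have g: "rho_factor n = (if odd n then 3 powr (-1/4) else 1) * c ^ row_exponent n" for n
    by (simp add: rho_factor_def c_def)
  have q: "(3 powr (-1/4))\<^sup>2 = 1 / sqrt (3::real)"
    by (simp add: power2_eq_square powr_minus_divide powr_half_sqrt flip: powr_add)
  show ?thesis
  proof (cases "even m")
    case True
    then have "row_exponent (m + 2) + row_exponent m = 2 * row_exponent (Suc m)"
      by (auto simp: row_exponent_def elim!: evenE)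
    then have "rho_factor (m + 2) * rho_factor m = (c ^ row_exponent (Suc m))\<^sup>2"
      using True by (simp add: rho_factor_def c_def mult_2 mult_2_right flip: power_add power_mult)
    moreover have "(rho_factor (Suc m))\<^sup>2 = 1 / sqrt 3 * (c ^ row_exponent (Suc m))\<^sup>2"
      using True q by (simp add: rho_factor_def c_def power_mult_distrib)
    ultimately show ?thesis using True by (simp add: coupling_def)
  next
    case False
    then have "row_exponent (m + 2) + row_exponent m = 2 * row_exponent (Suc m) + 1"
      by (auto simp: row_exponent_def elim!: oddE)
    then have "c ^ row_exponent (m + 2) * c ^ row_exponent m = c * (c ^ row_exponent (Suc m))\<^sup>2"
      by (simp only: power_mult power_Suc flip: power_add add.commute[of 1] Suc_eq_plus1)
         (simp add: power2_eq_square mult_2 power_add)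
    then have "rho_factor (m + 2) * rho_factor m = (3 powr (-1/4))\<^sup>2 * (c * (c ^ row_exponent (Suc m))\<^sup>2)"
      using False by (simp add: g power2_eq_square mult_ac)
    moreover have "(rho_factor (Suc m))\<^sup>2 = (c ^ row_exponent (Suc m))\<^sup>2"
      using False by (simp add: rho_factor_def c_def)
    ultimately show ?thesis using False unfolding q by (simp add: coupling_def c_def)
  qed
qed

lemma rho_wronskian:
  "pderiv (rho (m + 2)) * rho m - rho (m + 2) * pderiv (rho m) - [:of_int e:] * rho (m + 2) * rho m
    = - ([:of_int e:] * (if even m then [:0, 1:] else 1) * (rho (Suc m))\<^sup>2)"
proof -
  have "pderiv (rho (m + 2)) * rho m - rho (m + 2) * pderiv (rho m) - [:of_int e:] * rho (m + 2) * rho m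
      = smult (rho_factor (m + 2) * rho_factor m) (coupling (Suc m)) * (tau (Suc m))\<^sup>2"
    using arg_cong[OF tau_wronskian[OF tau_nonzero, of m], of "smult (rho_factor (m + 2) * rho_factor m)"]
    by (simp add: rho_def pderiv_smult smult_diff_right mult_ac)
  also have "\<dots> = - ([:of_int e:] * (if even m then [:0, 1:] else 1) * (rho (Suc m))\<^sup>2)"
    unfolding rho_factor_coupling rho_def by (simp add: power2_eq_square mult_ac)
  finally show ?thesis .
qed

abbreviation "S \<equiv> [:0, 1:] :: real poly"
abbreviation "D \<equiv> [:of_int e:] :: real poly"

lemma D_sq: "D * D = 1"
  by simp

text \<open>The Darboux step: \<open>rho_wronskian\<close> carries the equation from one
  neighbouring pair to the next, starting from the pair 1, 1, where every term is zero.\<close>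

lemma hirota_rho:
  "S * (pderiv (pderiv (rho (Suc n))) * rho n - 2 * pderiv (rho (Suc n)) * pderiv (rho n)
      + rho (Suc n) * pderiv (pderiv (rho n)))
    - (if even n then rho (Suc n) * pderiv (rho n) else pderiv (rho (Suc n)) * rho n)
    - D * S * (pderiv (rho (Suc n)) * rho n - rho (Suc n) * pderiv (rho n))
    + D * of_nat (Suc n div 2) * rho n * rho (Suc n) = 0"
proof (induction n)
  case 0
  show ?case by simp
next
  case (Suc n)
  note I = rho_wronskian[of n]
  note I' = arg_cong[OF I, of pderiv]
  show ?case
  proof (cases "even n")
    case False
    have "S * (pderiv (pderiv (rho (n + 2))) * rho (Suc n) - 2 * pderiv (rho (n + 2)) * pderiv (rho (Suc n))
      + rho (n + 2) * pderiv (pderiv (rho (Suc n)))) - rho (n + 2) * pderiv (rho (Suc n))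
      - D * S * (pderiv (rho (n + 2)) * rho (Suc n) - rho (n + 2) * pderiv (rho (Suc n)))
      + D * of_nat (Suc n div 2) * rho (Suc n) * rho (n + 2) = 0"
    proof (rule hirota_step_even[OF _ _ _ rho_nonzero[of n]])
      show "pderiv (pderiv (rho (n + 2))) * rho n - rho (n + 2) * pderiv (pderiv (rho n))
          - D * (pderiv (rho (n + 2)) * rho n + rho (n + 2) * pderiv (rho n))
          = - (D * (2 * rho (Suc n) * pderiv (rho (Suc n))))"
        using I' False
        by (simp add: pderiv_add pderiv_diff pderiv_minus pderiv_mult pderiv_smult power2_eq_square algebra_simps smult_add_right)
    qed (use Suc I False in simp_all)
    then show ?thesis using False by simp
  next
    case True
    have "S * (pderiv (pderiv (rho (n + 2))) * rho (Suc n) - 2 * pderiv (rho (n + 2)) * pderiv (rho (Suc n))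
      + rho (n + 2) * pderiv (pderiv (rho (Suc n)))) - pderiv (rho (n + 2)) * rho (Suc n)
      - D * S * (pderiv (rho (n + 2)) * rho (Suc n) - rho (n + 2) * pderiv (rho (Suc n)))
      + D * (of_nat (Suc n div 2) + 1) * rho (Suc n) * rho (n + 2) = 0"
    proof (rule hirota_step_odd[OF _ _ _ rho_nonzero[of n]])
      show "pderiv (pderiv (rho (n + 2))) * rho n - rho (n + 2) * pderiv (pderiv (rho n))
          - D * (pderiv (rho (n + 2)) * rho n + rho (n + 2) * pderiv (rho n))
          = - (D * ((rho (Suc n))\<^sup>2 + S * (2 * rho (Suc n) * pderiv (rho (Suc n)))))"
        using I' True
        by (simp add: pderiv_add pderiv_diff pderiv_minus pderiv_mult pderiv_smult pderiv_pCons power2_eq_square algebra_simps smult_add_right)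
    qed (use Suc I True in simp_all)
    moreover have m: "of_nat (Suc n div 2) + 1 = (of_nat (Suc (Suc n) div 2) :: real poly)"
      using True by auto
    ultimately show ?thesis using True unfolding m by simp
  qed
qed

section \<open>The Ohyama recurrence by way of a first order differential equation\<close>

definition ohyQ_rho :: "nat \<Rightarrow> real poly" where
  "ohyQ_rho n = ohyQ (e * int n) (rho n)"

lemma ohyQ_rho_eq: "ohyQ_rho n = (S + D * of_nat n) * (rho n)\<^sup>2 - 2 * (S * rho n * pderiv (pderiv (rho n)))
    + 2 * (S * (pderiv (rho n))\<^sup>2) - 2 * (rho n * pderiv (rho n))"
proof -
  have "[:of_int (e * int n), 1:] = S + D * of_nat n" by (simp add: of_nat_poly)
  moreover have "smult 2 q = 2 * q" for q :: "real poly" by (simp add: numeral_poly)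
  ultimately show ?thesis by (simp only: ohyQ_rho_def ohyQ_def mult.assoc)
qed

text \<open>Left unsimplified to match the hypotheses \<open>X1\<close> and \<open>Y1\<close> of the
  step lemmas literally.\<close>

lemma pderiv_ohyQ_rho: "pderiv (ohyQ_rho n) = (rho n)\<^sup>2 + (S + D * of_nat n) * (2 * rho n * pderiv (rho n))
    - 2 * (rho n * pderiv (pderiv (rho n)) + S * pderiv (rho n) * pderiv (pderiv (rho n))
        + S * rho n * pderiv (pderiv (pderiv (rho n))))
    + 2 * ((pderiv (rho n))\<^sup>2 + S * (2 * pderiv (rho n) * pderiv (pderiv (rho n))))
    - 2 * ((pderiv (rho n))\<^sup>2 + rho n * pderiv (pderiv (rho n)))"
proof -
  have [simp]: "pderiv S = 1" "pderiv D = 0" by (simp_all add: pderiv_pCons)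
  show ?thesis unfolding ohyQ_rho_eq
    by (simp add: pderiv_diff pderiv_add pderiv_mult power2_eq_square algebra_simps del: mult_pCons_left mult_pCons_right)
qed

text \<open>The relation \<open>rho_wronskian\<close> at \<open>n\<close> with \<open>rho (n - 1)\<close> eliminated by the recurrence at \<open>n\<close>, which
  makes it a statement about the pair \<open>rho n\<close>, \<open>rho (n + 1)\<close> that also makes sense for \<open>n = 0\<close>.\<close>

definition backlund :: "nat \<Rightarrow> bool" where
  "backlund n \<longleftrightarrow> S * rho (Suc n) * pderiv (ohyQ_rho n) = D * S\<^sup>2 * rho (Suc n) * (rho n)\<^sup>2
     + (- (D * S * rho (Suc n)) + (if even n then rho (Suc n) else 0) + 2 * S * pderiv (rho (Suc n))) * ohyQ_rho n"

text \<open>A first order linear differential equation for \<open>ohyQ_rho (Suc n)\<close> with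
  coefficients from \<open>rho n\<close> and \<open>rho (Suc n)\<close> only. The work lies in
  bringing \<open>hirota_rho\<close> and its derivative into the form of the step lemmas for each
  parity.\<close>

lemma backlund_forward:
  assumes "backlund n"
  shows "S * rho n * pderiv (ohyQ_rho (Suc n)) =
    (D * S * rho n + (if even n then 0 else rho n) + 2 * S * pderiv (rho n)) * ohyQ_rho (Suc n)
    - D * S\<^sup>2 * rho n * (rho (Suc n))\<^sup>2"
proof -
  note h = hirota_rho[of n]
  note J = assms[unfolded backlund_def]
  have [simp]: "pderiv S = 1" "pderiv D = 0" by (simp_all add: pderiv_pCons)
  have [simp]: "pderiv (of_nat k :: real poly) = 0" for k by (induction k) (auto simp: pderiv_add)
  show ?thesis
  proof (cases "even n")
    case True
    then obtain m where m: "n = 2 * m" by (auto elim: evenE)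
    have d: "Suc n div 2 = m" using m by simp
    have n: "of_nat n = 2 * (of_nat m :: real poly)" "of_nat (Suc n) = 2 * (of_nat m :: real poly) + 1"
      by (simp_all add: m)
    have h': "S * (pderiv (pderiv (rho (Suc n))) * rho n - 2 * pderiv (rho (Suc n)) * pderiv (rho n)
        + rho (Suc n) * pderiv (pderiv (rho n))) - rho (Suc n) * pderiv (rho n)
        - D * S * (pderiv (rho (Suc n)) * rho n - rho (Suc n) * pderiv (rho n))
        + D * of_nat m * rho n * rho (Suc n) = 0"
      using h True unfolding d by simp
    have h'': "pderiv (pderiv (rho (Suc n))) * rho n - 2 * pderiv (rho (Suc n)) * pderiv (rho n)
        + rho (Suc n) * pderiv (pderiv (rho n))
        + S * (pderiv (pderiv (pderiv (rho (Suc n)))) * rho n - pderiv (pderiv (rho (Suc n))) * pderiv (rho n)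
           - pderiv (rho (Suc n)) * pderiv (pderiv (rho n)) + rho (Suc n) * pderiv (pderiv (pderiv (rho n))))
        - pderiv (rho (Suc n)) * pderiv (rho n) - rho (Suc n) * pderiv (pderiv (rho n))
        - D * (pderiv (rho (Suc n)) * rho n - rho (Suc n) * pderiv (rho n))
        - D * S * (pderiv (pderiv (rho (Suc n))) * rho n - rho (Suc n) * pderiv (pderiv (rho n)))
        + D * of_nat m * (pderiv (rho n) * rho (Suc n) + rho n * pderiv (rho (Suc n))) = 0"
      using arg_cong[OF h', of pderiv]
      by (simp add: pderiv_add pderiv_diff pderiv_mult algebra_simps del: mult_pCons_left mult_pCons_right)
    have J': "S * rho (Suc n) * pderiv (ohyQ_rho n) = D * S\<^sup>2 * rho (Suc n) * (rho n)\<^sup>2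
        + (- (D * S * rho (Suc n)) + rho (Suc n) + 2 * S * pderiv (rho (Suc n))) * ohyQ_rho n"
      using J True by simp
    note Q1 = ohyQ_rho_eq[of n, unfolded n] and Q1' = pderiv_ohyQ_rho[of n, unfolded n]
      and Q2 = ohyQ_rho_eq[of "Suc n", unfolded n] and Q2' = pderiv_ohyQ_rho[of "Suc n", unfolded n]
    show ?thesis
      using backlund_step_even[OF Q1 Q1' Q2 Q2' J' h' h'' D_sq rho_nonzero] True by simp
  next
    case False
    then obtain m where m: "Suc n = 2 * m" by (metis even_Suc evenE)
    have d: "Suc n div 2 = m" using m by simp
    have n2: "of_nat (Suc n) = 2 * (of_nat m :: real poly)"
      by (simp only: m of_nat_mult of_nat_numeral)
    then have n1: "of_nat n = 2 * (of_nat m :: real poly) - 1"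
      by (simp add: eq_diff_eq add.commute)
    note n = n2 n1
    have h': "S * (pderiv (pderiv (rho (Suc n))) * rho n - 2 * pderiv (rho (Suc n)) * pderiv (rho n)
        + rho (Suc n) * pderiv (pderiv (rho n))) - pderiv (rho (Suc n)) * rho n
        - D * S * (pderiv (rho (Suc n)) * rho n - rho (Suc n) * pderiv (rho n))
        + D * of_nat m * rho n * rho (Suc n) = 0"
      using h False unfolding d by simp
    have h'': "pderiv (pderiv (rho (Suc n))) * rho n - 2 * pderiv (rho (Suc n)) * pderiv (rho n)
        + rho (Suc n) * pderiv (pderiv (rho n))
        + S * (pderiv (pderiv (pderiv (rho (Suc n)))) * rho n - pderiv (pderiv (rho (Suc n))) * pderiv (rho n)
           - pderiv (rho (Suc n)) * pderiv (pderiv (rho n)) + rho (Suc n) * pderiv (pderiv (pderiv (rho n))))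
        - pderiv (rho (Suc n)) * pderiv (rho n) - pderiv (pderiv (rho (Suc n))) * rho n
        - D * (pderiv (rho (Suc n)) * rho n - rho (Suc n) * pderiv (rho n))
        - D * S * (pderiv (pderiv (rho (Suc n))) * rho n - rho (Suc n) * pderiv (pderiv (rho n)))
        + D * of_nat m * (pderiv (rho n) * rho (Suc n) + rho n * pderiv (rho (Suc n))) = 0"
      using arg_cong[OF h', of pderiv]
      by (simp add: pderiv_add pderiv_diff pderiv_mult algebra_simps del: mult_pCons_left mult_pCons_right)
    have J': "S * rho (Suc n) * pderiv (ohyQ_rho n) = D * S\<^sup>2 * rho (Suc n) * (rho n)\<^sup>2
        + (- (D * S * rho (Suc n)) + 2 * S * pderiv (rho (Suc n))) * ohyQ_rho n"
      using J False by simp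
    note Q1 = ohyQ_rho_eq[of n, unfolded n] and Q1' = pderiv_ohyQ_rho[of n, unfolded n]
      and Q2 = ohyQ_rho_eq[of "Suc n", unfolded n] and Q2' = pderiv_ohyQ_rho[of "Suc n", unfolded n]
    show ?thesis
      using backlund_step_odd[OF Q1 Q1' Q2 Q2' J' h' h'' D_sq rho_nonzero] False by simp
  qed
qed

text \<open>Both sides solve the equation of \<open>backlund_forward\<close>, so their difference
  \<open>V\<close> solves the homogeneous one. For \<open>V\<close> nonzero, the term
  \<open>D * S * rho n * V\<close> would have degree one above the bound for the other two
  terms.\<close>

lemma ohyQ_rho_Suc:
  assumes "backlund n"
  shows "ohyQ_rho (Suc n) = ohyC (int (Suc n)) * rho n * rho (n + 2)"
proof (rule ccontr)
  define C where "C = ohyC (int (Suc n))"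
  define Z where "Z = C * rho n * rho (n + 2)"
  define V where "V = ohyQ_rho (Suc n) - Z"
  define w where "w = (if even n then 0 else rho n) + 2 * S * pderiv (rho n)"
  assume "\<not> ?thesis"
  then have V: "V \<noteq> 0" by (simp add: V_def Z_def C_def)
  have C: "C = (if even n then 1 else S)" by (simp add: C_def ohyC_def)
  have Z1: "S * rho n * pderiv Z = (D * S * rho n + w) * Z - D * S\<^sup>2 * rho n * (rho (Suc n))\<^sup>2"
  proof -
    have W: "pderiv (rho (n + 2)) * rho n = rho (n + 2) * pderiv (rho n) + D * rho (n + 2) * rho n
        - D * (if even n then S else 1) * (rho (Suc n))\<^sup>2"
      using rho_wronskian[of n] by (simp add: algebra_simps)
    have "pderiv Z = (if even n then 0 else 1) * rho n * rho (n + 2) + C * (pderiv (rho n) * rho (n + 2) + pderiv (rho (n + 2)) * rho n)"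
      unfolding Z_def C by (simp add: pderiv_mult pderiv_pCons algebra_simps)
    note P = this[unfolded W]
    show ?thesis unfolding P unfolding Z_def w_def C
      by (cases "even n") (simp_all add: algebra_simps power2_eq_square del: mult_pCons_left mult_pCons_right)
  qed
  have "S * rho n * pderiv V = (D * S * rho n + w) * V"
    using Z1 backlund_forward[OF assms]
    unfolding V_def w_def pderiv_diff by (simp only: algebra_simps)
  then have eq: "D * S * rho n * V = S * rho n * pderiv V - w * V" by (simp only: algebra_simps)
  have "of_int e \<noteq> (0::real)" using of_int_e_sq by (auto simp del: of_int_e_sq)
  then have "degree (D * S * rho n * V) = 1 + degree (rho n) + degree V"
    using V rho_nonzero by (simp add: degree_mult_eq)
  moreover have "degree (S * rho n * pderiv V) \<le> degree (rho n) + degree V"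
  proof (cases "pderiv V = 0")
    case False
    then have "degree V \<noteq> 0" by (simp add: pderiv_eq_0_iff)
    then show ?thesis using False rho_nonzero by (simp add: degree_mult_eq degree_pderiv)
  qed simp
  moreover have "degree (w * V) \<le> degree (rho n) + degree V"
  proof -
    have "degree (S * pderiv (rho n)) \<le> degree (rho n)"
    proof (cases "pderiv (rho n) = 0")
      case False
      then have "degree (rho n) \<noteq> 0" by (simp add: pderiv_eq_0_iff)
      then show ?thesis using False by (simp add: degree_pderiv)
    qed simp
    then have "degree w \<le> degree (rho n)"
      unfolding w_def by (intro degree_add_le) (auto simp: numeral_poly)
    then show ?thesis using degree_mult_le[of w V] by simp
  qed
  ultimately show False
    using degree_diff_le[of "S * rho n * pderiv V" "degree (rho n) + degree V" "w * V"] unfolding eq by simp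
qed

text \<open>Differentiates the recurrence just obtained, with \<open>rho_wronskian\<close> solved
  for the derivative of \<open>rho n\<close>; in \<open>ohyQ_rho_Suc\<close> it is solved for that
  of \<open>rho (n + 2)\<close>.\<close>

lemma backlund_Suc:
  assumes "backlund n"
  shows "backlund (Suc n)"
proof -
  define C where "C = ohyC (int (Suc n))"
  have C: "C = (if even n then 1 else S)" by (simp add: C_def ohyC_def)
  have ohyQ_rho: "ohyQ_rho (Suc n) = C * rho n * rho (n + 2)" using ohyQ_rho_Suc[OF assms] by (simp add: C_def)
  have W: "rho (n + 2) * pderiv (rho n) = pderiv (rho (n + 2)) * rho n - D * rho (n + 2) * rho n
      + D * (if even n then S else 1) * (rho (Suc n))\<^sup>2"
    using rho_wronskian[of n] by (simp add: algebra_simps)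
  have "pderiv (ohyQ_rho (Suc n)) = (if even n then 0 else 1) * rho n * rho (n + 2)
      + C * (rho (n + 2) * pderiv (rho n) + pderiv (rho (n + 2)) * rho n)"
    unfolding ohyQ_rho C by (simp add: pderiv_mult pderiv_pCons algebra_simps)
  note P = this[unfolded W]
  have "S * rho (n + 2) * pderiv (ohyQ_rho (Suc n)) = D * S\<^sup>2 * rho (n + 2) * (rho (Suc n))\<^sup>2
     + (- (D * S * rho (n + 2)) + (if even (Suc n) then rho (n + 2) else 0) + 2 * S * pderiv (rho (n + 2))) * ohyQ_rho (Suc n)"
    unfolding P unfolding ohyQ_rho C
    by (cases "even n") (simp_all add: algebra_simps power2_eq_square del: mult_pCons_left mult_pCons_right)
  then show ?thesis by (simp add: backlund_def)
qed

lemma backlund: "backlund n"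
proof (induction n)
  case 0
  \<comment> \<open>With \<open>rho 0\<close> and \<open>rho 1\<close> equal to 1, both sides of
    \<open>backlund 0\<close> reduce to \<open>S\<close>.\<close>
  have "ohyQ_rho 0 = S" by (simp add: ohyQ_rho_eq)
  then show ?case by (simp add: backlund_def pderiv_pCons power2_eq_square one_pCons)
next
  case (Suc n)
  then show ?case by (rule backlund_Suc)
qed

text \<open>The Ohyama polynomials are defined by polynomial \<open>div\<close>, so exact
  divisibility is the point. Since \<open>e\<close> is odd, the sign does not affect the parity in
  \<open>ohyC\<close>.\<close>

lemma rho_recurrence:
  "ohyQ (e * (int n + 1)) (rho (Suc n)) div (ohyC (e * (int n + 1)) * rho n) = rho (n + 2)"
proof -
  have "odd e" using e_sq by (metis even_mult_iff odd_one)
  then have C: "ohyC (e * (int n + 1)) = ohyC (int (Suc n))" by (simp add: ohyC_def)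
  have "ohyQ (e * (int n + 1)) (rho (Suc n)) = ohyC (int (Suc n)) * rho n * rho (n + 2)"
    using ohyQ_rho_Suc[OF backlund, of n] by (simp add: ohyQ_rho_def add.commute)
  moreover have "ohyC (int (Suc n)) * rho n \<noteq> 0" using rho_nonzero by (auto simp: ohyC_def)
  ultimately show ?thesis unfolding C by simp
qed

end

section \<open>Identification with the Ohyama polynomials\<close>

lemma (in wave_chain) ohy_up_eq:
  assumes "e = 1"
  shows "ohy_up k = (rho k, rho (Suc k))"
proof (induction k)
  case (Suc k)
  then show ?case using rho_recurrence[of k] assms by simp
qed simp

lemma (in wave_chain) ohy_down_eq:
  assumes "e = -1"
  shows "ohy_down k = (rho k, rho (Suc k))"
proof (induction k)
  case (Suc k)
  then show ?case using rho_recurrence[of k] assms by simp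
qed simp

subsection \<open>Reduction of the Wronskian\<close>

context
  fixes A :: "nat \<Rightarrow> nat \<Rightarrow> real"
  assumes A: "A_conditions A"
begin

lemma A_rec: "(real k + 2) / 3 * A (Suc m) (Suc (Suc k)) - A (Suc m) (Suc k)
    + 3 * sqrt 3 / (real k + 1) * (if k \<ge> 1 then A m (k - 1) else 0) = 0"
proof -
  have "(real (Suc k) + 1) / 3 * A (Suc m) (Suc k + 1) - A (Suc m) (Suc k)
    + 3 * sqrt 3 / real (Suc k) * (if Suc k \<ge> 2 then A (Suc m - 1) (Suc k - 2) else 0) = 0"
    using A unfolding A_conditions_def by (metis One_nat_def Suc_le_mono le0)
  moreover have "(Suc k \<ge> 2) = (k \<ge> 1)" by auto
  moreover have "Suc m - 1 = m" "Suc k - 2 = k - 1" by auto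
  ultimately show ?thesis by (simp add: add.commute split: if_splits)
qed

text \<open>The prescribed value at \<open>k = 2 * m + 2\<close> cancels the source term from the
  previous row, so the next coefficient is zero; beyond it the source vanishes by induction and the
  recurrence propagates zero.\<close>

lemma A_vanish: "k > 2 * m \<Longrightarrow> A m k = 0"
proof (induction m arbitrary: k)
  case 0
  then show ?case using A by (auto simp: A_conditions_def)
next
  case (Suc m)
  note Suc_IH = Suc.IH
  have lead: "A (Suc m) (Suc (Suc (2 * m))) = (3 * sqrt 3 / 2) ^ Suc m * 3 powr (1/4) / fact (Suc m)"
    using A unfolding A_conditions_def by (metis One_nat_def Suc_le_mono le0 mult_Suc_right add_2_eq_Suc)
  have lead': "A m (2 * m) = (3 * sqrt 3 / 2) ^ m * 3 powr (1/4) / fact m"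
    using A unfolding A_conditions_def by (cases "m = 0") auto
  have "A (Suc m) (Suc (Suc (Suc (2 * m + i)))) = 0" for i
  proof (induction i)
    case 0
    have "3 * sqrt 3 / (real (2 * m + 1) + 1) * A m (2 * m) = A (Suc m) (Suc (Suc (2 * m)))"
      unfolding lead lead' by (simp add: field_simps)
    then show ?case using A_rec[of "2 * m + 1" m] by (simp add: add_pos_nonneg)
  next
    case (Suc i)
    then show ?case using A_rec[of "2 * m + i + 2" m] Suc_IH[of "2 * m + i + 1"] by (simp add: add_pos_nonneg)
  qed
  then show ?case using Suc.prems by (metis add_2_eq_Suc less_iff_Suc_add mult_Suc_right add_Suc)
qed

definition chain_poly :: "int \<Rightarrow> nat \<Rightarrow> real poly" where
  "chain_poly e m = (\<Sum>k\<le>2*m. monom (A m k * (of_int e / 3) ^ k) k)"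

lemma coeff_chain_poly: "coeff (chain_poly e m) k = A m k * (of_int e / 3) ^ k"
  by (auto simp: chain_poly_def coeff_sum A_vanish)

text \<open>At the coefficient of degree \<open>k\<close> the differential equation is
  \<open>A_rec\<close> multiplied by \<open>3 * (k + 1)\<close>, which is
  \<open>X = 3 * Y\<close>.\<close>

lemma wave_chain_chain_poly:
  assumes e: "e * e = 1"
  shows "wave_chain e (chain_poly e)"
proof
  show "chain_poly e 0 = [:3 powr (1/4):]"
    using A by (simp add: chain_poly_def A_conditions_def monom_0)
next
  fix m
  have e': "of_int e * (of_int e * x) = x" for x :: real
    using e by (metis mult.assoc mult_1 of_int_1 of_int_mult)
  show "pderiv (pderiv (chain_poly e (Suc m))) = smult (of_int e) (pderiv (chain_poly e (Suc m)))
      - smult (of_int e / sqrt 3) ([:0, 1:] * chain_poly e m)"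
  proof (rule poly_eqI)
    fix k
    define u where "u = (of_int e / 3 :: real) ^ k"
    define X where "X = (real k + 1) * (real k + 2) * A (Suc m) (Suc (Suc k))"
    define Y where "Y = (real k + 1) * A (Suc m) (Suc k) - 3 * sqrt 3 * (if k \<ge> 1 then A m (k - 1) else 0)"
    have "X = 3 * Y"
      using A_rec[of k m] by (simp add: X_def Y_def field_simps split: if_splits)
    then have r: "X * u / 9 = Y * u / 3" by simp
    have l: "coeff (pderiv (pderiv (chain_poly e (Suc m)))) k = X * u / 9"
      by (simp add: X_def coeff_pderiv coeff_chain_poly u_def e' field_simps)
    show "coeff (pderiv (pderiv (chain_poly e (Suc m)))) k =
        coeff (smult (of_int e) (pderiv (chain_poly e (Suc m)))
          - smult (of_int e / sqrt 3) ([:0, 1:] * chain_poly e m)) k"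
      unfolding l r
      by (cases k) (auto simp: Y_def coeff_pderiv coeff_chain_poly e' field_simps u_def)
  qed
qed (rule e)

lemma W_eq_poly:
  assumes e: "e * e = 1"
  shows "W A (e * (int j + 1)) z = poly (chain_poly e j) (s_of z)"
proof -
  have "e = 1 \<or> e = -1" using e by (simp add: zmult_eq_1_iff)
  then have "nat \<bar>e * (int j + 1)\<bar> = Suc j" "sgn (e * (int j + 1)) = e"
    by (auto simp: sgn_mult)
  then show ?thesis
    by (simp add: W_def chain_poly_def poly_sum poly_monom atLeast0AtMost power_mult_distrib power_divide mult_ac)
qed

end

section \<open>Passage from derivatives in \<open>z\<close> to derivatives in
  \<open>s\<close>\<close>

definition ds_dz :: "real \<Rightarrow> real" where
  "ds_dz z = (z / 2) powr (-1/3)"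

text \<open>Turns the factor \<open>s\<close> in the coupling of odd rows into a constant.\<close>

lemma ds_dz_sq: "z > 0 \<Longrightarrow> (ds_dz z)\<^sup>2 * s_of z = 3"
  by (simp add: ds_dz_def s_of_def power2_eq_square flip: powr_add)

text \<open>The derivative is a polynomial in \<open>ds_dz\<close> itself, so polynomials in
  \<open>ds_dz\<close> are closed under differentiation in \<open>z\<close>.\<close>

lemma ds_dz_deriv: "z > 0 \<Longrightarrow> (ds_dz has_field_derivative (- ((ds_dz z)^4) / 6)) (at z)"
proof -
  assume z: "z > 0"
  have p4: "(ds_dz z)^4 = (z / 2) powr (-1/3 - 1)"
    using z by (simp add: ds_dz_def powr_power)
  show ?thesis unfolding p4 unfolding ds_dz_def
    using z by (auto intro!: derivative_eq_intros)
qed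

lemma s_of_deriv: "z > 0 \<Longrightarrow> (s_of has_field_derivative ds_dz z) (at z)"
  unfolding ds_dz_def s_of_def by (auto intro!: derivative_eq_intros)

context wave_chain
begin

text \<open>Scaled so that row \<open>l + 1\<close> enters the \<open>z\<close>-derivative of row
  \<open>l\<close> with coefficient 1.\<close>

definition row_factor :: "nat \<Rightarrow> real \<Rightarrow> real" where
  "row_factor l z = (- (sqrt 3 * of_int e)) ^ (l div 2) * ds_dz z ^ (l mod 2)"

definition chain_row :: "nat \<Rightarrow> nat \<Rightarrow> real \<Rightarrow> real" where
  "chain_row l j z = row_factor l z * poly (entry l j) (s_of z)"

text \<open>Coefficient of row \<open>l\<close> in its own \<open>z\<close>-derivative, as a
  polynomial in \<open>ds_dz\<close>: the linear term stems from the first order term of the chain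
  equation, the cubic one from differentiating \<open>ds_dz\<close>.\<close>

definition damping :: "nat \<Rightarrow> real poly" where
  "damping l = (if even l then 0 else [:0, of_int e, 0, -1/6:])"

text \<open>Coefficients, as polynomials in \<open>ds/dz\<close>, of the unitriangular row operations that express
  \<open>z\<close>-derivatives by the rows \<open>chain_row\<close>.\<close>

primrec deriv_coeff :: "nat \<Rightarrow> nat \<Rightarrow> real poly" where
  "deriv_coeff 0 = (\<lambda>l. if l = 0 then 1 else 0)"
| "deriv_coeff (Suc i) = (\<lambda>l. - smult (1/6) (monom 1 4 * pderiv (deriv_coeff i l))
     + (if l = 0 then 0 else deriv_coeff i (l - 1)) + damping l * deriv_coeff i l)"

lemma deriv_coeff_upper: "l > i \<Longrightarrow> deriv_coeff i l = 0"
  by (induction i arbitrary: l) auto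

lemma deriv_coeff_diag: "deriv_coeff i i = 1"
  by (induction i) (auto simp: deriv_coeff_upper)

lemma chain_row_deriv:
  assumes z: "z > 0"
  shows "(chain_row l j has_field_derivative (chain_row (Suc l) j z + poly (damping l) (ds_dz z) * chain_row l j z)) (at z)"
proof (cases "even l")
  case True
  then have pe: "pderiv (entry l j) = entry (Suc l) j"
    using pderiv_entry[of l j] by (simp add: coupling_def)
  have "((\<lambda>z. poly (entry l j) (s_of z)) has_field_derivative poly (pderiv (entry l j)) (s_of z) * ds_dz z) (at z)"
    by (rule DERIV_chain2[OF poly_DERIV s_of_deriv[OF z]])
  from DERIV_cmult[OF this, of "(- (sqrt 3 * of_int e)) ^ (l div 2)"]
  show ?thesis using True unfolding chain_row_def[abs_def] row_factor_def
    by (simp add: pe damping_def mod_Suc mult_ac)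
next
  case False
  have pe: "poly (pderiv (entry l j)) s = of_int e * poly (entry l j) s - of_int e / sqrt 3 * s * poly (entry (Suc l) j) s" for s
    using pderiv_entry[of l j] False by (simp add: coupling_def)
  have "((\<lambda>z. poly (entry l j) (s_of z)) has_field_derivative poly (pderiv (entry l j)) (s_of z) * ds_dz z) (at z)"
    by (rule DERIV_chain2[OF poly_DERIV s_of_deriv[OF z]])
  moreover define c where "c = (- (sqrt 3 * of_int e)) ^ (l div 2)"
  ultimately have "((\<lambda>z. c * ds_dz z * poly (entry l j) (s_of z)) has_field_derivative
     c * (- ((ds_dz z)^4) / 6) * poly (entry l j) (s_of z) + c * ds_dz z * (poly (pderiv (entry l j)) (s_of z) * ds_dz z)) (at z)"
    by (intro DERIV_cong[OF DERIV_mult[OF DERIV_cmult[OF ds_dz_deriv[OF z], of c]]]) (auto simp: mult_ac)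
  moreover have "chain_row l j = (\<lambda>z. c * ds_dz z * poly (entry l j) (s_of z))"
    using False by (simp add: chain_row_def[abs_def] row_factor_def c_def odd_iff_mod_2_eq_one)
  moreover have "c * (- ((ds_dz z)^4) / 6) * poly (entry l j) (s_of z) + c * ds_dz z * (poly (pderiv (entry l j)) (s_of z) * ds_dz z)
     = chain_row (Suc l) j z + poly (damping l) (ds_dz z) * chain_row l j z"
  proof -
    have t: "ds_dz z * (ds_dz z * (s_of z * x)) = 3 * x" for x
      using ds_dz_sq[OF z] by (simp add: power2_eq_square flip: mult.assoc)
    have s3: "of_int e / sqrt 3 * 3 = sqrt 3 * of_int e"
      by (simp add: field_simps)
    have "c * ds_dz z * (of_int e / sqrt 3 * s_of z * x * ds_dz z) = sqrt 3 * of_int e * c * x" for x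
    proof -
      have "c * ds_dz z * (of_int e / sqrt 3 * s_of z * x * ds_dz z) = c * (of_int e / sqrt 3) * (ds_dz z * (ds_dz z * (s_of z * x)))"
        by (simp only: mult_ac)
      also have "\<dots> = c * (of_int e / sqrt 3 * 3) * x" unfolding t by (simp only: mult_ac)
      also have "\<dots> = sqrt 3 * of_int e * c * x" unfolding s3 by (simp only: mult_ac)
      finally show ?thesis .
    qed
    moreover have "Suc l div 2 = Suc (l div 2)" using False by presburger
    ultimately have R': "chain_row (Suc l) j z = - (c * ds_dz z * (of_int e / sqrt 3 * s_of z * poly (entry (Suc l) j) (s_of z) * ds_dz z))"
      using False by (simp add: chain_row_def row_factor_def c_def odd_iff_mod_2_eq_one mod_Suc)
    have chain_row: "chain_row l j z = c * ds_dz z * poly (entry l j) (s_of z)"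
      using False by (simp add: chain_row_def row_factor_def c_def odd_iff_mod_2_eq_one)
    have a: "poly (damping l) (ds_dz z) = of_int e * ds_dz z - (ds_dz z)^3 / 6"
      using False by (simp add: damping_def power3_eq_cube algebra_simps)
    show ?thesis unfolding pe R' chain_row a
      by (simp add: algebra_simps power4_eq_xxxx power3_eq_cube)
  qed
  ultimately show ?thesis by simp
qed

lemma higher_deriv_eq:
  assumes "z > 0"
  shows "(deriv ^^ i) (\<lambda>z. poly (p j) (s_of z)) z = (\<Sum>l\<le>i. poly (deriv_coeff i l) (ds_dz z) * chain_row l j z)"
  using assms
proof (induction i arbitrary: z)
  case 0
  then show ?case by (simp add: chain_row_def row_factor_def)
next
  case (Suc i)
  let ?g = "\<lambda>z. \<Sum>l\<le>i. poly (deriv_coeff i l) (ds_dz z) * chain_row l j z"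
  let ?t = "ds_dz z" and ?q = "\<lambda>l. - smult (1/6) (monom 1 4 * pderiv (deriv_coeff i l)) + damping l * deriv_coeff i l"
  have d: "((\<lambda>z. poly (deriv_coeff i l) (ds_dz z)) has_field_derivative poly (pderiv (deriv_coeff i l)) ?t * (- (?t^4) / 6)) (at z)" for l
    by (rule DERIV_chain2[OF poly_DERIV ds_dz_deriv[OF \<open>z > 0\<close>]])
  have "(?g has_field_derivative (\<Sum>l\<le>i. poly (pderiv (deriv_coeff i l)) ?t * (- (?t^4) / 6) * chain_row l j z
      + poly (deriv_coeff i l) ?t * (chain_row (Suc l) j z + poly (damping l) ?t * chain_row l j z))) (at z)"
    by (intro DERIV_sum DERIV_cong[OF DERIV_mult[OF d chain_row_deriv[OF \<open>z > 0\<close>]]]) (simp add: mult_ac)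
  also have "(\<Sum>l\<le>i. poly (pderiv (deriv_coeff i l)) ?t * (- (?t^4) / 6) * chain_row l j z
      + poly (deriv_coeff i l) ?t * (chain_row (Suc l) j z + poly (damping l) ?t * chain_row l j z))
    = (\<Sum>l\<le>i. poly (?q l) ?t * chain_row l j z) + (\<Sum>l\<le>i. poly (deriv_coeff i l) ?t * chain_row (Suc l) j z)"
    by (simp add: poly_monom algebra_simps flip: sum.distrib)
  also have "(\<Sum>l\<le>i. poly (?q l) ?t * chain_row l j z) = (\<Sum>l\<le>Suc i. poly (?q l) ?t * chain_row l j z)"
    by (simp add: deriv_coeff_upper)
  also have "(\<Sum>l\<le>i. poly (deriv_coeff i l) ?t * chain_row (Suc l) j z)
      = (\<Sum>l\<le>Suc i. poly (if l = 0 then 0 else deriv_coeff i (l - 1)) ?t * chain_row l j z)"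
    by (subst sum.atMost_Suc_shift) simp
  also have "(\<Sum>l\<le>Suc i. poly (?q l) ?t * chain_row l j z) + \<dots> = (\<Sum>l\<le>Suc i. poly (deriv_coeff (Suc i) l) ?t * chain_row l j z)"
    unfolding sum.distrib[symmetric] by (intro sum.cong refl) (simp add: algebra_simps)
  \<comment> \<open>The induction hypothesis gives equality for positive arguments only, so the
    derivative is transferred on that open set.\<close>
  finally have "((deriv ^^ i) (\<lambda>z. poly (p j) (s_of z)) has_field_derivative
      (\<Sum>l\<le>Suc i. poly (deriv_coeff (Suc i) l) ?t * chain_row l j z)) (at z)"
    by (rule has_field_derivative_transform_within_open[of _ _ _ "{0<..}"]) (use Suc in auto)
  then show ?case by (simp add: DERIV_imp_deriv del: deriv_coeff.simps sum.atMost_Suc)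
qed

lemma prod_row_factor: "(\<Prod>l<n. row_factor l z) = (- (sqrt 3 * of_int e)) ^ row_exponent n * ds_dz z ^ (n div 2)"
proof (induction n)
  case 0
  show ?case by (simp add: row_exponent_def)
next
  case (Suc n)
  have "n div 2 + n mod 2 = Suc n div 2" by presburger
  then have "ds_dz z ^ (Suc n div 2) = ds_dz z ^ (n div 2) * ds_dz z ^ (n mod 2)" by (metis power_add)
  then show ?case using Suc by (simp add: row_exponent_def row_factor_def power_add)
qed

text \<open>The Wronskian matrix is \<open>B * M\<close> with \<open>B\<close> lower unitriangular,
  so only the row factors of \<open>M\<close> are added to \<open>tau\<close>.\<close>

lemma wronskian_eq:
  assumes z: "z > 0"
  shows "wronskian (\<lambda>j z. poly (p j) (s_of z)) n z
    = (- (sqrt 3 * of_int e)) ^ row_exponent n * ds_dz z ^ (n div 2) * poly (tau n) (s_of z)"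
proof -
  define B where "B = mat n n (\<lambda>(i, l). poly (deriv_coeff i l) (ds_dz z))"
  define M where "M = mat n n (\<lambda>(l, j). chain_row l j z)"
  have "mat n n (\<lambda>(i, j). (deriv ^^ i) (\<lambda>z. poly (p j) (s_of z)) z) = B * M"
  proof (rule eq_matI)
    fix i j assume "i < dim_row (B * M)" "j < dim_col (B * M)"
    then have ij: "i < n" "j < n" by (auto simp: B_def M_def)
    have "(\<Sum>l\<le>i. poly (deriv_coeff i l) (ds_dz z) * chain_row l j z) = (\<Sum>l<n. poly (deriv_coeff i l) (ds_dz z) * chain_row l j z)"
      using ij by (intro sum.mono_neutral_left) (auto simp: deriv_coeff_upper)
    then show "mat n n (\<lambda>(i, j). (deriv ^^ i) (\<lambda>z. poly (p j) (s_of z)) z) $$ (i, j) = (B * M) $$ (i, j)"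
      using ij by (simp add: higher_deriv_eq[OF z] B_def M_def scalar_prod_def atLeast0LessThan)
  qed (auto simp: B_def M_def)
  then have "wronskian (\<lambda>j z. poly (p j) (s_of z)) n z = det B * det M"
    unfolding wronskian_def by (simp add: det_mult[of _ n] B_def M_def)
  moreover have "det B = 1"
  proof -
    have "det B = prod_list (diag_mat B)"
      by (rule det_lower_triangular[of n]) (auto simp: B_def deriv_coeff_upper)
    also have "diag_mat B = map (\<lambda>_. 1) [0..<n]" by (auto simp: diag_mat_def B_def deriv_coeff_diag)
    also have "prod_list (map (\<lambda>_. 1 :: real) xs) = 1" for xs :: "nat list" by (induction xs) auto
    finally show ?thesis .
  qed
  moreover have "det M = (\<Prod>l<n. row_factor l z) * poly (tau n) (s_of z)"
  proof -
    have "poly (signof q) x = signof q" for q :: "nat \<Rightarrow> nat" and x :: real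
      by (auto simp: sign_def)
    then show ?thesis
      unfolding M_def tau_def det_mat_eq_sum
      by (simp add: chain_row_def prod.distrib poly_sum poly_prod sum_distrib_left atLeast0LessThan mult_ac)
  qed
  ultimately show ?thesis by (simp add: prod_row_factor)
qed

end

text \<open>The power of \<open>s / 3\<close> in the theorem compensates exactly for the factors
  \<open>ds_dz\<close> of the odd rows.\<close>

lemma ds_dz_power_cancel:
  assumes "z > 0"
  shows "(s_of z / 3) powr (real k / 2) * ds_dz z ^ k = 1"
  using assms by (simp add: s_of_def ds_dz_def powr_powr powr_power flip: powr_add)

theorem theorem3:
  fixes A :: "nat \<Rightarrow> nat \<Rightarrow> real" and n :: int and z :: real
  assumes "A_conditions A" and "z > 0"
  shows "poly (ohyama n) (s_of z) =
    (if odd n then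
       3 powr (-1/4) * (s_of z / 3) powr ((real_of_int \<bar>n\<bar> - 1) / 4)
         * wronskian (\<lambda>j. W A (sgn n * (int j + 1))) (nat \<bar>n\<bar>) z
     else
       (s_of z / 3) powr (real_of_int \<bar>n\<bar> / 4)
         * wronskian (\<lambda>j. W A (sgn n * (int j + 1))) (nat \<bar>n\<bar>) z)"
proof (cases "n = 0")
  \<comment> \<open>Here \<open>sgn n\<close> is 0 and no chain is available; the empty determinant
    is 1.\<close>
  case True
  then show ?thesis using \<open>z > 0\<close> by (simp add: ohyama_def wronskian_def s_of_def)
next
  case False
  define e where "e = sgn n"
  define N where "N = nat \<bar>n\<bar>"
  have e: "e * e = 1" using False by (auto simp: e_def sgn_if)
  interpret wave_chain e "chain_poly A e"
    by (rule wave_chain_chain_poly[OF assms(1) e])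
  have rho: "ohyama n = rho N"
    using False ohy_up_eq ohy_down_eq by (auto simp: ohyama_def N_def e_def sgn_if)
  have "W A (e * (int j + 1)) = (\<lambda>z. poly (chain_poly A e j) (s_of z))" for j
    using W_eq_poly[OF assms(1) e] by (intro ext)
  then have wr: "wronskian (\<lambda>j. W A (e * (int j + 1))) N z
      = (- (sqrt 3 * of_int e)) ^ row_exponent N * ds_dz z ^ (N div 2) * poly (tau N) (s_of z)"
    using wronskian_eq[OF assms(2)] by simp
  \<comment> \<open>One formula for both parities: \<open>N div 2\<close> is the number of odd
    rows.\<close>
  have exponent: "(if odd n then (real_of_int \<bar>n\<bar> - 1) / 4 else real_of_int \<bar>n\<bar> / 4) = real (N div 2) / 2"
  proof -
    have "real_of_int \<bar>n\<bar> = real N" "odd n = odd N" by (auto simp: N_def even_nat_iff)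
    then show ?thesis by (auto elim!: evenE oddE)
  qed
  have "poly (rho N) (s_of z) = (if odd N then 3 powr (-1/4) else 1) *
      ((s_of z / 3) powr (real (N div 2) / 2) * wronskian (\<lambda>j. W A (e * (int j + 1))) N z)"
    using ds_dz_power_cancel[OF assms(2), of "N div 2"] unfolding wr rho_def rho_factor_def by simp
  moreover have "odd n = odd N" by (simp add: N_def even_nat_iff)
  ultimately show ?thesis
    using exponent unfolding rho e_def[symmetric] N_def[symmetric]
    by (cases "odd n") (simp_all only: if_True if_False not_not mult_1 mult.assoc simp_thms)
qed

end
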